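(* For every fixed integer $k\ge 2$, \[ \lim_{n\rightarrow\infty} \overline{m}(n,k)\cdot\frac{k(k-1)}{n(n-1)}=1 . \]
   Context: A hypergraph is an ordered pair $(X,H)$ such that $X$ is a set (of vertices) and $H$ is a family of subsets of $X$ (edges, which may have arbitrary sizes). A set $T$ of vertices in a hypergraph is called affinely closed if, and only if, every edge that shares at least two vertices with $T$ is fully contained in $T$. For every set $S$ of vertices, the affine closure $\mathrm{aff}(S)$ is the intersection of all affinely closed supersets of $S$ (it is itself affinely closed). The closure-lines in the hypergraph are all the sets $\mathrm{aff}(\{u,v\})$ with $u$ and $v$ two distinct vertices. For integers $n,k$, $\overline{m}(n,k)$ denotes the smallest number of (distinct) closure-lines in a hypergraph on $n$ vertices where every closure-line consists of at most $k$ vertices. *)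

theory Defs
  imports Complex_Main
begin

definition hypergraph :: "'a set \<Rightarrow> 'a set set \<Rightarrow> bool" where
  "hypergraph X H \<longleftrightarrow> (\<forall>e\<in>H. e \<subseteq> X)"

(* "Sharing at least two vertices" is phrased with two distinct common elements rather than
   with card, so that it is also correct for infinite intersections. *)
definition affinely_closed :: "'a set \<Rightarrow> 'a set set \<Rightarrow> 'a set \<Rightarrow> bool" where
  "affinely_closed X H T \<longleftrightarrow>
     T \<subseteq> X \<and> (\<forall>e\<in>H. (\<exists>u v. u \<in> e \<inter> T \<and> v \<in> e \<inter> T \<and> u \<noteq> v) \<longrightarrow> e \<subseteq> T)"

definition aff :: "'a set \<Rightarrow> 'a set set \<Rightarrow> 'a set \<Rightarrow> 'a set" where
  "aff X H S = \<Inter> {T. affinely_closed X H T \<and> S \<subseteq> T}"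

definition closure_lines :: "'a set \<Rightarrow> 'a set set \<Rightarrow> 'a set set" where
  "closure_lines X H = {aff X H {u, v} | u v. u \<in> X \<and> v \<in> X \<and> u \<noteq> v}"

(* Closure-lines are invariant under isomorphism, so it is enough to let the vertices range
   over natural numbers. For k >= 2 the minimum exists: with no edges at all, every
   closure-line is a pair. *)
definition mbar :: "nat \<Rightarrow> nat \<Rightarrow> nat" where
  "mbar n k = (LEAST m. \<exists>(X :: nat set) H.
     finite X \<and> card X = n \<and> hypergraph X H \<and>
     (\<forall>L \<in> closure_lines X H. card L \<le> k) \<and>
     card (closure_lines X H) = m)"

end

theory Submission
  imports Defs
begin

text \<open>
  Every pair of vertices lies in a closure-line, and a closure-line covers at most
  \<open>k choose 2\<close> pairs; this gives the lower bound. Conversely, take a family of \<open>p\<close> sets of size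
  \<open>k\<close>, any two of which share at most one vertex, and add the pairs contained in none of them: the
  closure-lines of this hypergraph are exactly its edges, so it suffices to make the family cover
  almost all pairs. To do so, split the vertices into \<open>k\<close> groups of size \<open>m\<close>, where \<open>m\<close> is
  congruent to 1 modulo \<open>k!\<close>. Then all differences of distinct group indices are invertible modulo
  \<open>m\<close>, so the \<open>m\<^sup>2\<close> affine functions modulo \<open>m\<close> form sets covering each pair from different groups
  exactly once. Recursing inside the groups divides the proportion of uncovered pairs by \<open>k\<close>
  at every level, up to a loss linear in the number of vertices.
\<close>

section \<open>Packings and their transport along injections\<close>

text \<open>For k \<ge> 2 this is a partial Steiner system with block size k, that is, a family of
  edge-disjoint copies of the complete graph on k vertices inside the complete graph on
  \<open>X\<close>.\<close>

definition packing :: "nat \<Rightarrow> 'a set \<Rightarrow> 'a set set \<Rightarrow> bool" where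
  "packing k X B \<longleftrightarrow> (\<forall>e\<in>B. e \<subseteq> X \<and> card e = k) \<and>
     (\<forall>e\<in>B. \<forall>f\<in>B. \<forall>u v. u \<noteq> v \<longrightarrow> {u, v} \<subseteq> e \<longrightarrow> {u, v} \<subseteq> f \<longrightarrow> e = f)"

lemma packing_unique:
  assumes "packing k X B" "e \<in> B" "f \<in> B" "u \<noteq> v" "{u, v} \<subseteq> e" "{u, v} \<subseteq> f"
  shows "e = f"
  using assms(1)[unfolded packing_def, THEN conjunct2, rule_format, OF assms(2-6)] .

lemma packing_finite:
  assumes "packing k X B" "finite X"
  shows "finite B"
  using assms by (meson Pow_iff finite_Pow_iff finite_subset packing_def subsetI)

lemma packing_image:
  assumes "packing k X B" "inj_on f X"
  shows "packing k (f ` X) ((`) f ` B)" "card ((`) f ` B) = card B"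
proof -
  have sub: "\<And>e. e \<in> B \<Longrightarrow> e \<subseteq> X" and size: "\<And>e. e \<in> B \<Longrightarrow> card e = k"
    using assms(1) unfolding packing_def by auto
  note uniq = packing_unique[OF assms(1)]
  have "e = e'"
    if e: "e \<in> B" "e' \<in> B" and uv: "u \<noteq> v" "{u, v} \<subseteq> f ` e" "{u, v} \<subseteq> f ` e'" for e e' u v
  proof -
    obtain x y where xy: "x \<in> e" "y \<in> e" "u = f x" "v = f y"
      using uv by auto
    have "x \<in> X" "y \<in> X" "f x \<in> f ` e'" "f y \<in> f ` e'"
      using xy uv(3) sub[OF e(1)] by auto
    then have "x \<in> e'" "y \<in> e'"
      using inj_on_image_mem_iff[OF assms(2) _ sub[OF e(2)]] by blast+
    then show ?thesis
      using uniq[OF e, of x y] xy uv(1) by auto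
  qed
  moreover have "card (f ` e) = k" if "e \<in> B" for e
    using card_image[OF inj_on_subset[OF assms(2) sub[OF that]]] size[OF that] by simp
  ultimately show "packing k (f ` X) ((`) f ` B)"
    using sub unfolding packing_def ball_simps by blast
  show "card ((`) f ` B) = card B"
    using inj_on_subset[OF inj_on_image_Pow[OF assms(2)]] sub by (intro card_image) auto
qed

lemma packing_mono:
  assumes "packing k X B" "X \<subseteq> Y"
  shows "packing k Y B"
  using assms unfolding packing_def by blast

text \<open>Lets the recursion build blocks on pairs (group, residue) and return to an initial
  segment of the naturals; surplus vertices lie in no block.\<close>

lemma packing_transfer:
  assumes "packing k X B" "finite X" "card X \<le> n"
  shows "\<exists>B'. packing k {..<n::nat} B' \<and> card B' = card B"
proof -
  obtain f where f: "bij_betw f X {..<card X}"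
    using ex_bij_betw_finite_nat[OF assms(2)] by (auto simp: atLeast0LessThan)
  then have "packing k {..<card X} ((`) f ` B)" "card ((`) f ` B) = card B"
    using packing_image[OF assms(1), of f] by (auto simp: bij_betw_def)
  then show ?thesis
    using packing_mono[of k "{..<card X}" _ "{..<n}"] assms(3) by auto
qed

section \<open>Affine functions modulo m and the recursive construction\<close>

definition graph_line :: "nat \<Rightarrow> nat \<Rightarrow> nat \<times> nat \<Rightarrow> (nat \<times> nat) set" where
  "graph_line k m ab = (\<lambda>i. (i, (fst ab + snd ab * i) mod m)) ` {..<k}"

lemma two_le_card_distinct:
  assumes "2 \<le> card e"
  shows "\<exists>u\<in>e. \<exists>v\<in>e. u \<noteq> v"
proof -
  obtain T where "T \<subseteq> e" "card T = 2"
    using obtain_subset_with_card_n[OF assms] by metis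
  then show ?thesis by (auto simp: card_2_iff)
qed

text \<open>Subtracting the congruences at two distinct indices i and j shows that m divides (b -
  b')(i - j). The second factor has absolute value below k, hence is invertible modulo m, so b and
  b' are congruent, and then so are a and a'. All four are reduced residues, so congruence is
  equality.\<close>

lemma graph_line_unique:
  assumes cop: "\<And>d. 0 < d \<Longrightarrow> d < k \<Longrightarrow> coprime d m"
    and ab: "a < m" "b < m" "a' < m" "b' < m"
    and uv: "u \<noteq> v" "{u, v} \<subseteq> graph_line k m (a, b)" "{u, v} \<subseteq> graph_line k m (a', b')"
  shows "a = a' \<and> b = b'"
proof -
  have small: "x = y" if "int m dvd int x - int y" "x < m" "y < m" for x y
    using that by (metis mod_eq_dvd_iff mod_less of_nat_eq_iff zmod_int)
  obtain i j where ij: "i < k" "j < k" "i \<noteq> j"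
    and "(a + b * i) mod m = (a' + b' * i) mod m" "(a + b * j) mod m = (a' + b' * j) mod m"
    using uv unfolding graph_line_def by auto
  moreover have "int m dvd (int a + int b * int t) - (int a' + int b' * int t)"
    if "(a + b * t) mod m = (a' + b' * t) mod m" for t
    using arg_cong[OF that, of int] by (simp add: of_nat_mod mod_eq_dvd_iff)
  ultimately have i: "int m dvd (int a + int b * int i) - (int a' + int b' * int i)"
    and j: "int m dvd (int a + int b * int j) - (int a' + int b' * int j)"
    by blast+
  have "int m dvd (int b - int b') * (int i - int j)"
    using dvd_diff[OF i j] by (simp add: algebra_simps)
  moreover have "coprime (int m) (int i - int j)"
  proof (cases "i < j")
    case True
    then have "coprime (int m) (int (j - i))"
      using cop[of "j - i"] ij by (simp add: coprime_commute del: of_nat_diff)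
    moreover have "int i - int j = - int (j - i)" using True by simp
    ultimately show ?thesis by (simp only: coprime_minus_right_iff)
  next
    case False
    then have "coprime (int m) (int (i - j))"
      using cop[of "i - j"] ij by (simp add: coprime_commute del: of_nat_diff)
    moreover have "int i - int j = int (i - j)" using False by simp
    ultimately show ?thesis by (simp only:)
  qed
  ultimately have "int m dvd int b - int b'"
    by (simp add: coprime_dvd_mult_left_iff)
  then have "b = b'" using small ab by blast
  then have "a = a'" using small i ab by simp
  with \<open>b = b'\<close> show ?thesis by simp
qed

text \<open>The vertices form k groups of size m. The sets in \<open>L\<close> meet every group
  exactly once, while the copies of \<open>B\<close> in \<open>G i\<close> stay inside group i, so
  no pair is shared between the two kinds; the count is m^2 plus k copies of \<open>B\<close>. The
  slack in k * m \<le> n leaves room for rounding.\<close>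

lemma packing_step:
  assumes k: "k \<ge> 2" and cop: "\<And>d. 0 < d \<Longrightarrow> d < k \<Longrightarrow> coprime d m"
    and B: "packing k {..<m} B" and n: "k * m \<le> n"
  shows "\<exists>B'. packing k {..<n} B' \<and> card B' = m\<^sup>2 + k * card B"
proof -
  define G where "G i = (`) (Pair i) ` B" for i :: nat
  define L where "L = graph_line k m ` ({..<m} \<times> {..<m})"
  define C where "C = L \<union> (\<Union>i<k. G i)"
  let ?X = "{..<k} \<times> {..<m}"
  have finB: "finite B" using packing_finite[OF B] by simp
  have Gpack: "packing k (Pair i ` {..<m}) (G i)" and Gcard: "card (G i) = card B" for i
    using packing_image[OF B, of "Pair i"] by (auto simp: G_def inj_on_def)
  have Gmem: "fst u = i" if "e \<in> G i" "u \<in> e" for e u i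
    using that by (auto simp: G_def)
  \<comment> \<open>This turns a common block into a common pair, so that injectivity and
    disjointness below follow from the uniqueness facts on pairs.\<close>
  have two: "\<exists>u\<in>e. \<exists>v\<in>e. u \<noteq> v" if "card e = k" for e :: "(nat \<times> nat) set"
    using that k two_le_card_distinct by blast
  have Gcards: "card e = k" if "e \<in> G i" for e i
    using Gpack[of i] that by (auto simp: packing_def)
  have Lcards: "card e = k" if "e \<in> L" for e
    using that by (auto simp: L_def graph_line_def card_image inj_on_def)
  have LL: "e = f" if ef: "e \<in> L" "f \<in> L" and uv: "u \<noteq> v" "{u, v} \<subseteq> e" "{u, v} \<subseteq> f"
    for e f u v
  proof -
    obtain a b a' b' where "e = graph_line k m (a, b)" "f = graph_line k m (a', b')"
      "a < m" "b < m" "a' < m" "b' < m"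
      using ef unfolding L_def by blast
    then show ?thesis using graph_line_unique[of k m a b a' b' u v] cop uv by simp
  qed
  have LG: False if "e \<in> L" "f \<in> G i" "u \<noteq> v" "{u, v} \<subseteq> e" "{u, v} \<subseteq> f" for e f i u v
  proof -
    have "fst u = i" "fst v = i" using that Gmem by auto
    then show False using that by (auto simp: L_def graph_line_def)
  qed
  have GG: "i = j \<and> e = f"
    if "e \<in> G i" "f \<in> G j" "u \<noteq> v" "{u, v} \<subseteq> e" "{u, v} \<subseteq> f" for e f i j u v
  proof -
    have "i = j" using Gmem[OF that(1), of u] Gmem[OF that(2), of u] that(4,5) by simp
    moreover from this have "e = f" using packing_unique[OF Gpack _ _ that(3-5)] that(1,2) by simp
    ultimately show ?thesis by blast
  qed
  have "packing k ?X C"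
    unfolding packing_def
  proof (intro conjI ballI allI impI)
    fix e assume e: "e \<in> C"
    then show "card e = k" using Gcards Lcards by (auto simp: C_def)
    show "e \<subseteq> ?X"
      using e B by (auto simp: C_def L_def G_def graph_line_def packing_def)
  next
    fix e f u v assume "e \<in> C" "f \<in> C" "u \<noteq> v" "{u, v} \<subseteq> e" "{u, v} \<subseteq> f"
    then show "e = f"
      unfolding C_def using LL[of e f u v] LG[of e f _ u v] LG[of f e _ u v] GG[of e _ f _ u v]
      by blast
  qed
  moreover have "card C = m\<^sup>2 + k * card B"
  proof -
    have "inj_on (graph_line k m) ({..<m} \<times> {..<m})"
    proof (rule inj_onI)
      fix x y assume xy: "x \<in> {..<m} \<times> {..<m}" "y \<in> {..<m} \<times> {..<m}"
        "graph_line k m x = graph_line k m y"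
      then obtain u v where "u \<noteq> v" "{u, v} \<subseteq> graph_line k m x"
        using two[OF Lcards, of "graph_line k m x"] unfolding L_def by blast
      then show "x = y"
        using graph_line_unique[of k m "fst x" "snd x" "fst y" "snd y" u v] cop xy
        by (auto simp: prod_eq_iff)
    qed
    then have "card L = m\<^sup>2"
      by (simp add: L_def card_image power2_eq_square)
    moreover have "card (\<Union>i<k. G i) = (\<Sum>i<k. card (G i))"
    proof (rule card_UN_disjoint)
      show "\<forall>i\<in>{..<k}. \<forall>j\<in>{..<k}. i \<noteq> j \<longrightarrow> G i \<inter> G j = {}"
      proof (intro ballI impI)
        fix i j :: nat assume "i \<noteq> j"
        then have False if "e \<in> G i" "e \<in> G j" for e
          using two[OF Gcards[OF that(1)]] GG[OF that] by blast
        then show "G i \<inter> G j = {}" by blast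
      qed
    qed (auto simp: G_def finB)
    moreover have "L \<inter> (\<Union>i<k. G i) = {}"
    proof -
      have False if "e \<in> L" "e \<in> G i" for e i
        using two[OF Gcards[OF that(2)]] LG[OF that] by blast
      then show ?thesis by blast
    qed
    moreover have "finite L" "finite (\<Union>i<k. G i)"
      by (auto simp: L_def G_def finB)
    ultimately show ?thesis
      by (simp add: C_def card_Un_disjoint Gcard)
  qed
  ultimately show ?thesis
    using packing_transfer[of k ?X C n] n by auto
qed

section \<open>Asymptotic density of packings\<close>

text \<open>A packing of all pairs would have about c n^2 blocks, and \<delta> measures the
  shortfall. With m about n/k, the construction gives 1 + k(c - \<delta>) times n^2/k^2 blocks.
  Since 1 + kc = ck^2, the value c is a fixed point and the shortfall is divided by k. The linear
  coefficient grows because n must be rounded down to k * m.\<close>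

lemma packing_density_step:
  fixes c C \<delta> :: real
  assumes k: "k \<ge> 2" and c: "c = 1 / (real k * (real k - 1))" and d: "0 \<le> \<delta>" "\<delta> \<le> c"
    and C: "0 \<le> C"
    and IH: "\<And>m. \<exists>B. packing k {..<m} B \<and> real (card B) \<ge> (c - \<delta>) * (real m)\<^sup>2 - C * real m"
  shows "\<exists>B. packing k {..<n} B \<and>
    real (card B) \<ge> (c - \<delta> / k) * (real n)\<^sup>2 - (C + 2 * c * k * fact k) * real n"
proof -
  define R :: nat where "R = k * fact k"
  define D where "D = c - \<delta> / k"
  have c0: "0 < c" using k c by simp
  have dk: "\<delta> / k \<le> \<delta>" "0 \<le> \<delta> / k" using k d mult_left_mono[of 1 "real k" \<delta>] by (auto simp: divide_le_eq)
  have D: "0 \<le> D" "D \<le> c" using d dk by (auto simp: D_def)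
  have R: "C + 2 * c * k * fact k = C + 2 * c * R" by (simp add: R_def)
  show ?thesis
  proof (cases "n < k")
    \<comment> \<open>For n < k the difference n - k would be truncated. Here the empty packing
      suffices, as the linear allowance outweighs the quadratic term.\<close>
    case True
    have "n \<le> R" using True unfolding R_def
      by (metis fact_ge_1 le_trans less_imp_le mult.right_neutral mult_le_mono2)
    have "D * (real n)\<^sup>2 \<le> c * (real R * real n)"
      unfolding power2_eq_square using D c0 \<open>n \<le> R\<close>
      by (intro mult_mono) auto
    also have "\<dots> \<le> (C + 2 * c * R) * real n"
      using C c0 by (simp add: algebra_simps)
    finally have "packing k {..<n} {} \<and>
      real (card ({} :: nat set set)) \<ge> D * (real n)\<^sup>2 - (C + 2 * c * R) * real n"
      by (simp add: packing_def)
    then show ?thesis unfolding D_def R by blast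
  next
    case False
    \<comment> \<open>With this t, k * m is the largest number up to n that is congruent to k modulo
      \<open>R\<close>; thus m is 1 modulo k! and fewer than \<open>R\<close> vertices are left
      over.\<close>
    define t where "t = (n - k) div R"
    define m where "m = 1 + t * fact k"
    have Rpos: "R > 0" using k by (simp add: R_def)
    have km: "k * m = k + R * t" by (simp add: m_def R_def algebra_simps)
    have mod: "(n - k) mod R < R" "R * t + (n - k) mod R = n - k"
      using Rpos by (auto simp: t_def)
    then have n: "k * m \<le> n" "n \<le> k * m + R" using km False by linarith+
    have cop: "coprime d m" if "0 < d" "d < k" for d
    proof -
      have "d dvd t * fact k" using that by (simp add: dvd_fact)
      then show ?thesis unfolding m_def
        by (metis coprime_1_right coprime_add_one_right coprime_commute coprime_divisors
            dvd_refl add.commute)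
    qed
    obtain B where B: "packing k {..<m} B" "real (card B) \<ge> (c - \<delta>) * (real m)\<^sup>2 - C * real m"
      using IH by blast
    obtain B' where B': "packing k {..<n} B'" "card B' = m\<^sup>2 + k * card B"
      using packing_step[OF k cop B(1) n(1)] by blast
    define x where "x = real k * real m"
    have x: "0 \<le> x" "x \<le> real n" "real n \<le> x + real R"
      using n by (auto simp: x_def simp flip: of_nat_mult of_nat_add)
    have id: "(1 + k * (c - \<delta>)) = D * (real k)\<^sup>2"
      using k unfolding c D_def by (simp add: field_simps power2_eq_square)
    \<comment> \<open>Rounding n down to x = k * m costs at most 2Rn in the square; since
      \<open>D\<close> \<le> c, this yields the term 2cR of the new linear coefficient.\<close>
    have "(real n)\<^sup>2 - x\<^sup>2 = (real n - x) * (real n + x)"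
      by (simp add: power2_eq_square algebra_simps)
    also have "\<dots> \<le> real R * (2 * real n)"
      using x by (intro mult_mono) auto
    finally have sq: "(real n)\<^sup>2 - x\<^sup>2 \<le> 2 * real R * real n" by simp
    have "D * (real n)\<^sup>2 - D * x\<^sup>2 \<le> D * (2 * real R * real n)"
      using mult_left_mono[OF sq D(1)] by (simp add: algebra_simps)
    also have "\<dots> \<le> c * (2 * real R * real n)"
      using D(2) by (intro mult_right_mono) auto
    finally have 1: "D * (real n)\<^sup>2 - D * x\<^sup>2 \<le> c * (2 * real R * real n)" .
    have 2: "C * x \<le> C * real n" using x C by (intro mult_left_mono) auto
    have "real (card B') = (real m)\<^sup>2 + k * real (card B)" using B' by simp
    also have "\<dots> \<ge> (real m)\<^sup>2 + k * ((c - \<delta>) * (real m)\<^sup>2 - C * real m)"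
      using B(2) by (simp add: mult_left_mono)
    also have "(real m)\<^sup>2 + k * ((c - \<delta>) * (real m)\<^sup>2 - C * real m)
        = (1 + k * (c - \<delta>)) * (real m)\<^sup>2 - C * x"
      by (simp add: x_def algebra_simps)
    also have "\<dots> = D * x\<^sup>2 - C * x"
      unfolding id by (simp add: x_def power_mult_distrib)
    finally have "real (card B') \<ge> D * (real n)\<^sup>2 - (C + 2 * c * R) * real n"
      using 1 2 by (simp add: algebra_simps)
    then show ?thesis using B'(1) unfolding D_def R by blast
  qed
qed

text \<open>Iteration starts from shortfall c, where the empty packing is enough, and after d rounds
  reaches c/k^d, which drops below any positive \<delta>. The constant depends on d but not on n, so
  its term vanishes in the limit.\<close>

lemma packing_density:
  fixes c \<delta> :: real
  assumes k: "k \<ge> 2" and c: "c = 1 / (real k * (real k - 1))" and "\<delta> > 0"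
  shows "\<exists>C. \<forall>n. \<exists>B. packing k {..<n} B \<and>
    real (card B) \<ge> (c - \<delta>) * (real n)\<^sup>2 - C * real n"
proof -
  have c0: "0 < c" using k c by simp
  have *: "\<exists>C\<ge>0. \<forall>n. \<exists>B. packing k {..<n} B \<and>
    real (card B) \<ge> (c - c / real k ^ d) * (real n)\<^sup>2 - C * real n" for d
  proof (induction d)
    case 0
    have "packing k {..<n} ({} :: nat set set)" for n by (simp add: packing_def)
    then show ?case by (intro exI[of _ 0]) (auto intro!: exI[of _ "{}"])
  next
    case (Suc d)
    then obtain C where C: "C \<ge> 0" "\<And>n. \<exists>B. packing k {..<n} B \<and>
      real (card B) \<ge> (c - c / real k ^ d) * (real n)\<^sup>2 - C * real n" by blast
    have "0 \<le> c / real k ^ d" "c / real k ^ d \<le> c"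
      using c0 k by (auto simp: divide_le_eq mult_le_cancel_left1)
    note step = packing_density_step[OF k c this C]
    have "0 \<le> C + 2 * c * k * fact k" using C(1) c0 by simp
    moreover have "c / real k ^ d / k = c / real k ^ Suc d" by (simp add: mult.commute)
    ultimately show ?case using step by (metis (no_types, lifting))
  qed
  obtain d where "(1 / real k) ^ d < \<delta> / c"
    using real_arch_pow_inv[of "\<delta> / c" "1 / real k"] assms(3) c0 k by auto
  then have d: "c / real k ^ d < \<delta>"
    using c0 by (simp add: power_one_over field_simps)
  obtain C where C: "\<And>n. \<exists>B. packing k {..<n} B \<and>
      real (card B) \<ge> (c - c / real k ^ d) * (real n)\<^sup>2 - C * real n" using *[of d] by blast
  have "(c - c / real k ^ d) * (real n)\<^sup>2 \<ge> (c - \<delta>) * (real n)\<^sup>2" for n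
    using d by (intro mult_right_mono) auto
  then show ?thesis using C by (meson diff_right_mono order_trans)
qed

section \<open>Upper bound from packings\<close>

text \<open>An edge shares two vertices with no edge but itself, so it is affinely closed; and any
  closed set containing two of its vertices must contain it. Hence the closure of a pair is the
  unique edge through it.\<close>

lemma closure_lines_eq:
  assumes H: "hypergraph X H"
    and two: "\<And>e. e \<in> H \<Longrightarrow> \<exists>u\<in>e. \<exists>v\<in>e. u \<noteq> v"
    and ex: "\<And>u v. u \<in> X \<Longrightarrow> v \<in> X \<Longrightarrow> u \<noteq> v \<Longrightarrow> \<exists>e\<in>H. {u, v} \<subseteq> e"
    and uniq: "\<And>e f u v. e \<in> H \<Longrightarrow> f \<in> H \<Longrightarrow> u \<noteq> v \<Longrightarrow> {u, v} \<subseteq> e \<Longrightarrow> {u, v} \<subseteq> f \<Longrightarrow> e = f"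
  shows "closure_lines X H = H"
proof -
  have aff: "aff X H {u, v} = e" if e: "e \<in> H" "u \<in> e" "v \<in> e" "u \<noteq> v" for e u v
  proof -
    have "affinely_closed X H e"
      using H e(1) uniq unfolding affinely_closed_def hypergraph_def by blast
    moreover have "e \<subseteq> T" if "affinely_closed X H T" "{u, v} \<subseteq> T" for T
      using that e unfolding affinely_closed_def by blast
    ultimately show ?thesis using e unfolding aff_def by blast
  qed
  show ?thesis
  proof
    show "closure_lines X H \<subseteq> H"
      unfolding closure_lines_def using ex aff by fastforce
    show "H \<subseteq> closure_lines X H"
    proof
      fix e assume e: "e \<in> H"
      then obtain u v where uv: "u \<in> e" "v \<in> e" "u \<noteq> v" using two by blast
      then have "u \<in> X" "v \<in> X" using H e by (auto simp: hypergraph_def)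
      then show "e \<in> closure_lines X H"
        using aff[OF e uv] uv(3) unfolding closure_lines_def by blast
    qed
  qed
qed

lemma card_two_subset_iff: "(P \<subseteq> e \<and> card P = 2) \<longleftrightarrow> (\<exists>u v. u \<noteq> v \<and> P = {u, v} \<and> {u, v} \<subseteq> e)"
  by (auto simp: card_2_iff)

text \<open>The witness has the blocks of \<open>B\<close> and the set \<open>U\<close> of uncovered
  pairs as edges. Each block replaces k choose 2 pairs by one line; the inequality is arranged
  additively to avoid truncated subtraction.\<close>

lemma mbar_upper:
  assumes k: "k \<ge> 2" and B: "packing k {..<n} B"
  shows "mbar n k + card B * (k choose 2) \<le> (n choose 2) + card B"
proof -
  define pairs where "pairs e = {P. P \<subseteq> e \<and> card P = 2}" for e :: "nat set"
  define U where "U = pairs {..<n} - (\<Union>e\<in>B. pairs e)"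
  have sub: "\<And>e. e \<in> B \<Longrightarrow> e \<subseteq> {..<n}" and size: "\<And>e. e \<in> B \<Longrightarrow> card e = k"
    using B unfolding packing_def by auto
  note uniq = packing_unique[OF B]
  have finB: "finite B" using packing_finite[OF B] by simp
  have fin: "finite e" if "e \<in> B" for e using finite_subset[OF sub[OF that]] by simp
  have cp: "card (pairs e) = card e choose 2" if "finite e" for e
    unfolding pairs_def using n_subsets[OF that] .
  have finp: "finite (pairs e)" if "finite e" for e using that by (simp add: pairs_def)
  have "card (\<Union>e\<in>B. pairs e) = (\<Sum>e\<in>B. card (pairs e))"
  proof (rule card_UN_disjoint[OF finB])
    show "\<forall>e\<in>B. finite (pairs e)" using fin finp by blast
    show "\<forall>e\<in>B. \<forall>f\<in>B. e \<noteq> f \<longrightarrow> pairs e \<inter> pairs f = {}"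
    proof (intro ballI impI)
      fix e f assume ef: "e \<in> B" "f \<in> B" "e \<noteq> f"
      have False if P: "P \<in> pairs e" "P \<in> pairs f" for P
      proof -
        obtain u v where "u \<noteq> v" "P = {u, v}" using P by (auto simp: pairs_def card_2_iff)
        then show False using uniq[OF ef(1,2), of u v] P ef(3) by (simp add: pairs_def)
      qed
      then show "pairs e \<inter> pairs f = {}" by blast
    qed
  qed
  also have "\<dots> = card B * (k choose 2)"
    using cp fin size by simp
  finally have cov: "card (\<Union>e\<in>B. pairs e) = card B * (k choose 2)" .
  have "(\<Union>e\<in>B. pairs e) \<subseteq> pairs {..<n}"
    using sub unfolding pairs_def by blast
  then have "card (pairs {..<n}) = card U + card (\<Union>e\<in>B. pairs e)"
    unfolding U_def using finp[of "{..<n}"]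
    by (simp add: card_Diff_subset finite_subset card_mono)
  then have U: "card U + card B * (k choose 2) = n choose 2"
    using cov cp[of "{..<n}"] by simp
  have H: "hypergraph {..<n} (B \<union> U)"
    using sub by (auto simp: hypergraph_def U_def pairs_def)
  have sizes: "card e = k \<or> card e = 2" if "e \<in> B \<union> U" for e
    using that size by (auto simp: U_def pairs_def)
  have Upair: "e = {u, v}" if "e \<in> U" "u \<noteq> v" "{u, v} \<subseteq> e" for e u v
    using that unfolding U_def pairs_def card_two_subset_iff by auto
  have cross: False if "e \<in> B" "f \<in> U" "u \<noteq> v" "{u, v} \<subseteq> e" "{u, v} \<subseteq> f" for e f u v
    using Upair[OF that(2,3,5)] that unfolding U_def pairs_def by auto
  have cl: "closure_lines {..<n} (B \<union> U) = B \<union> U"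
  proof (rule closure_lines_eq[OF H])
    fix e assume "e \<in> B \<union> U"
    then have "card e \<ge> 2" using sizes k by force
    then show "\<exists>u\<in>e. \<exists>v\<in>e. u \<noteq> v" by (rule two_le_card_distinct)
  next
    fix u v assume "u \<in> {..<n}" "v \<in> {..<n}" "u \<noteq> v"
    then have uv: "{u, v} \<in> pairs {..<n}" by (simp add: pairs_def)
    show "\<exists>e\<in>B \<union> U. {u, v} \<subseteq> e"
    proof (cases "{u, v} \<in> U")
      case False
      with uv obtain e where "e \<in> B" "{u, v} \<in> pairs e" unfolding U_def by blast
      then show ?thesis unfolding pairs_def by blast
    qed blast
  next
    fix e f u v
    assume "e \<in> B \<union> U" "f \<in> B \<union> U" "u \<noteq> v" "{u, v} \<subseteq> e" "{u, v} \<subseteq> f"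
    then show "e = f"
      using uniq[of e f u v] Upair[of e u v] Upair[of f u v] cross[of e f u v] cross[of f e u v]
      by blast
  qed
  have "mbar n k \<le> card (B \<union> U)"
    unfolding mbar_def
  proof (rule Least_le, intro exI conjI)
    show "hypergraph {..<n} (B \<union> U)" by (rule H)
    show "\<forall>L\<in>closure_lines {..<n} (B \<union> U). card L \<le> k" unfolding cl using sizes k by force
    show "card (closure_lines {..<n} (B \<union> U)) = card (B \<union> U)" unfolding cl ..
  qed auto
  also have "\<dots> \<le> card B + card U" by (rule card_Un_le)
  finally show ?thesis using U by simp
qed

section \<open>Lower bound by counting pairs\<close>

lemma closure_lines_lower:
  assumes X: "finite X" and H: "hypergraph X H"
    and le: "\<And>L. L \<in> closure_lines X H \<Longrightarrow> card L \<le> k"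
  shows "card X choose 2 \<le> card (closure_lines X H) * (k choose 2)"
proof -
  let ?CL = "closure_lines X H"
  define pairs where "pairs e = {P. P \<subseteq> e \<and> card P = 2}" for e :: "'a set"
  \<comment> \<open>As \<open>X\<close> itself is closed, lines stay inside \<open>X\<close> and are
    finite. This matters because an infinite set has \<open>card\<close> 0 and would satisfy the
    size bound trivially.\<close>
  have affX: "aff X H S \<subseteq> X" if "S \<subseteq> X" for S
    using that H unfolding aff_def affinely_closed_def hypergraph_def by blast
  have CLX: "L \<subseteq> X" if L: "L \<in> ?CL" for L
  proof -
    obtain u v where "L = aff X H {u, v}" "u \<in> X" "v \<in> X"
      using L unfolding closure_lines_def by blast
    then show ?thesis using affX[of "{u, v}"] by simp
  qed
  then have finCL: "finite ?CL" using X by (intro finite_subset[of ?CL "Pow X"]) auto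
  have finL: "finite L" if "L \<in> ?CL" for L using CLX[OF that] X finite_subset by blast
  have "pairs X \<subseteq> (\<Union>L\<in>?CL. pairs L)"
  proof
    fix P assume "P \<in> pairs X"
    then obtain u v where P: "P = {u, v}" "u \<noteq> v" "u \<in> X" "v \<in> X"
      unfolding pairs_def card_two_subset_iff by auto
    then have "aff X H P \<in> ?CL" unfolding closure_lines_def by blast
    moreover have "P \<in> pairs (aff X H P)" using P by (auto simp: pairs_def aff_def)
    ultimately show "P \<in> (\<Union>L\<in>?CL. pairs L)" by blast
  qed
  then have "card (pairs X) \<le> card (\<Union>L\<in>?CL. pairs L)"
    using finCL finL by (intro card_mono) (auto simp: pairs_def)
  also have "\<dots> \<le> (\<Sum>L\<in>?CL. card (pairs L))" by (rule card_UN_le[OF finCL])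
  also have "\<dots> \<le> (\<Sum>L\<in>?CL. k choose 2)"
    using finL le by (intro sum_mono) (auto simp: pairs_def n_subsets binomial_right_mono)
  finally show ?thesis using X by (simp add: pairs_def n_subsets)
qed

text \<open>The counting bound applies to \<open>mbar\<close> only if the minimum is attained. The
  edgeless hypergraph, whose lines are the pairs, shows that some value is admissible, since k \<ge>
  2.\<close>

lemma mbar_lower:
  assumes "k \<ge> 2"
  shows "n choose 2 \<le> mbar n k * (k choose 2)"
proof -
  let ?P = "\<lambda>m. \<exists>(X :: nat set) H. finite X \<and> card X = n \<and> hypergraph X H \<and>
     (\<forall>L \<in> closure_lines X H. card L \<le> k) \<and> card (closure_lines X H) = m"
  have cl: "closure_lines X {} = {{u, v} | u v. u \<in> X \<and> v \<in> X \<and> u \<noteq> v}" for X :: "nat set"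
  proof -
    have "aff X {} {u, v} = {u, v}" if "u \<in> X" "v \<in> X" for u v
    proof -
      have "affinely_closed X {} {u, v}" using that by (simp add: affinely_closed_def)
      then show ?thesis unfolding aff_def by blast
    qed
    then show ?thesis unfolding closure_lines_def by (intro Collect_cong ex_cong1) auto
  qed
  have "\<forall>L \<in> closure_lines {..<n} {}. card L \<le> k"
    unfolding cl using assms by auto
  then have "?P (card (closure_lines {..<n} {}))"
    by (intro exI[of _ "{..<n}"] exI[of _ "{}"]) (auto simp: hypergraph_def)
  then have "?P (mbar n k)" unfolding mbar_def by (rule LeastI)
  then show ?thesis using closure_lines_lower by metis
qed

section \<open>Passage to the limit\<close>

lemma real_choose_two: "real (n choose 2) = real n * (real n - 1) / 2"
  by (cases n) (auto simp: choose_two real_of_nat_div algebra_simps)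

theorem theorem8:
  fixes k :: nat
  assumes "k \<ge> 2"
  shows "(\<lambda>n. real (mbar n k) * ((real k * (real k - 1)) / (real n * (real n - 1))))
           \<longlonglongrightarrow> 1"
proof (rule order_tendstoI)
  define K where "K = real k * (real k - 1)"
  define a where "a n = real (mbar n k) * (K / (real n * (real n - 1)))" for n
  \<comment> \<open>Makes K - 2 nonnegative, so that lower bounds on the number of blocks can be
    multiplied by it.\<close>
  have K: "K \<ge> 2"
    using mult_mono[of 2 "real k" 1 "real k - 1"] assms by (simp add: K_def)
  have lower: "a n \<ge> 1" if "n \<ge> 2" for n
  proof -
    have "real (n choose 2) \<le> real (mbar n k) * real (k choose 2)"
      using mbar_lower[OF assms, of n] by (metis of_nat_le_iff of_nat_mult)
    then show ?thesis using that by (simp add: a_def K_def real_choose_two field_simps)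
  qed
  show "\<forall>\<^sub>F n in sequentially. y < real (mbar n k) *
      (real k * (real k - 1) / (real n * (real n - 1)))" if "y < 1" for y
    using eventually_ge_at_top[of 2] unfolding K_def[symmetric] a_def[symmetric]
    by eventually_elim (use lower that in force)
  show "\<forall>\<^sub>F n in sequentially. real (mbar n k) *
      (real k * (real k - 1) / (real n * (real n - 1))) < y" if y: "1 < y" for y
  proof -
    \<comment> \<open>The first bound keeps 1/K - \<delta> nonnegative, which allows n^2 to be
      replaced by n(n - 1). The second makes K(K - 2)\<delta> at most (y - 1)/2, so the limit of the
      upper bound stays below 2y.\<close>
    define \<delta> where "\<delta> = min (1 / K) ((y - 1) / (2 * K * K))"
    have d: "0 < \<delta>" "\<delta> \<le> 1 / K" "\<delta> \<le> (y - 1) / (2 * K * K)"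
      using K y by (auto simp: \<delta>_def)
    have "K * (K - 2) * \<delta> \<le> K * K * ((y - 1) / (2 * K * K))"
      using d K by (intro mult_mono) auto
    also have "\<dots> = (y - 1) / 2" using K by simp
    finally have lim_lt: "2 + K * (K - 2) * \<delta> < 2 * y" using y by simp
    obtain C where C: "\<And>n. \<exists>B. packing k {..<n} B \<and>
        real (card B) \<ge> (1 / K - \<delta>) * (real n)\<^sup>2 - C * real n"
      using packing_density[OF assms refl d(1)] unfolding K_def[symmetric] by blast
    \<comment> \<open>Doubling clears the halves in the binomials. The main term arises because N/K
      blocks would leave N - (N/K)(K - 2) = 2N/K.\<close>
    have upper: "2 * a n \<le> 2 + K * (K - 2) * \<delta> + K * (K - 2) * (C / (real n - 1))"
      if n: "n \<ge> 2" for n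
    proof -
      define N where "N = real n * (real n - 1)"
      have N: "N > 0" using n by (simp add: N_def)
      obtain B where B: "packing k {..<n} B"
        "real (card B) \<ge> (1 / K - \<delta>) * (real n)\<^sup>2 - C * real n"
        using C by blast
      define p where "p = real (card B)"
      have "real (mbar n k + card B * (k choose 2)) \<le> real ((n choose 2) + card B)"
        using mbar_upper[OF assms B(1)] of_nat_le_iff by blast
      then have m: "2 * real (mbar n k) \<le> N - p * (K - 2)"
        by (simp add: real_choose_two K_def N_def p_def field_simps)
      have "(1 / K - \<delta>) * N \<le> (1 / K - \<delta>) * (real n)\<^sup>2"
        using d by (intro mult_left_mono) (auto simp: N_def power2_eq_square algebra_simps)
      then have "p \<ge> (1 / K - \<delta>) * N - C * real n" using B(2) by (simp add: p_def)
      then have "p * (K - 2) \<ge> ((1 / K - \<delta>) * N - C * real n) * (K - 2)"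
        using K by (intro mult_right_mono) auto
      with m have "2 * real (mbar n k) \<le> N - ((1 / K - \<delta>) * N - C * real n) * (K - 2)"
        by linarith
      then have "2 * real (mbar n k) * K / N
          \<le> (N - ((1 / K - \<delta>) * N - C * real n) * (K - 2)) * K / N"
        using K N by (intro divide_right_mono mult_right_mono) auto
      also have "\<dots> = 2 + K * (K - 2) * \<delta> + K * (K - 2) * (C * real n / N)"
        using K N by (simp add: field_simps)
      also have "C * real n / N = C / (real n - 1)"
        using n by (simp add: N_def)
      finally show ?thesis by (simp add: a_def N_def)
    qed
    have "filterlim (\<lambda>n. real n - 1) at_top sequentially"
      using filterlim_tendsto_add_at_top[OF tendsto_const[of "-1"] filterlim_real_sequentially]
      by simp
    then have "(\<lambda>n. C / (real n - 1)) \<longlonglongrightarrow> 0"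
      by (rule real_tendsto_divide_at_top[OF tendsto_const])
    then have "(\<lambda>n. 2 + K * (K - 2) * \<delta> + K * (K - 2) * (C / (real n - 1)))
        \<longlonglongrightarrow> 2 + K * (K - 2) * \<delta> + K * (K - 2) * 0"
      by (intro tendsto_intros)
    then have "\<forall>\<^sub>F n in sequentially.
        2 + K * (K - 2) * \<delta> + K * (K - 2) * (C / (real n - 1)) < 2 * y"
      using lim_lt by (intro order_tendstoD(2)) auto
    then show ?thesis
      using eventually_ge_at_top[of 2] unfolding K_def[symmetric] a_def[symmetric]
      by eventually_elim (use upper in force)
  qed
qed

end
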